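(* There is an absolute constant $A>0$ such that for every positive integer $k$ there exists a multi-layer graph $\mathcal{G}=(V,\{C_1,C_2\},R)$ with $|V|\leq A k^3$ such that: each of the simple graphs $(V,R)$, $(V,C_1)$, $(V,C_2)$ is connected; $\mathsf{c}((V,R))\leq 3$; $\mathsf{c}((V,C_i))\leq 2$ for $i\in\{1,2\}$; and the multi-layer cop number of $\mathcal{G}$ is at least $k$.
   Context: For a simple graph $G$, $\mathsf{c}(G)$ is its (classical) cop number: the least number of cops that have a winning strategy in the cops and robber game on $G$ (cops placed first, then the robber, alternating turns starting with the cops, each agent stays or moves along one edge per turn, cops win if one occupies the robber's vertex). A multi-layer graph with designated layers is $(V,\{C_1,\dots,C_\tau\},R)$ with cop layers $C_i\subseteq\binom V2$ and robber layer $R\subseteq\binom V2$. In the multi-layer game with allocation $(k_1,\dots,k_\tau)$, $k_i$ cops are assigned to layer $C_i$ and move only along edges of $C_i$, the robber moves only along edges of $R$, otherwise the rules are as in the classical game. The multi-layer cop number is the least $k$ such that some allocation with $\sum_i k_i=k$ gives the cop player a winning strategy. *)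

theory Defs
  imports Complex_Main "Graph_Theory.Graph_Theory"
begin

section \<open>Simple graphs and multi-layer graphs\<close>

definition two_subsets :: "'a set \<Rightarrow> 'a set set" where
  "two_subsets V = {e. e \<subseteq> V \<and> card e = 2}"

definition graph_of :: "'a set \<Rightarrow> 'a set set \<Rightarrow> ('a, 'a \<times> 'a) pre_digraph" where
  "graph_of V E = with_proj \<lparr>pverts = V, parcs = {(u, v). {u, v} \<in> E}\<rparr>"

text \<open>The cop layers form a list, so that an allocation can refer to them by index.\<close>

definition multi_layer_graph :: "'a set \<Rightarrow> 'a set set list \<Rightarrow> 'a set set \<Rightarrow> bool" where
  "multi_layer_graph V Cs R \<longleftrightarrow>
     finite V \<and> (\<forall>C \<in> set Cs. C \<subseteq> two_subsets V) \<and> R \<subseteq> two_subsets V"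


section \<open>The game\<close>

definition move :: "'a set set \<Rightarrow> 'a \<Rightarrow> 'a \<Rightarrow> bool" where
  "move E u v \<longleftrightarrow> v = u \<or> {u, v} \<in> E"

text \<open>The robber is placed on \<open>\<rho> 0\<close>, and \<open>\<rho> t\<close> is his vertex after \<open>t\<close> moves. Plays are
  infinite; what happens after a capture is irrelevant.\<close>

definition robber_play :: "'a set \<Rightarrow> 'a set set \<Rightarrow> (nat \<Rightarrow> 'a) \<Rightarrow> bool" where
  "robber_play V R \<rho> \<longleftrightarrow> (\<forall>t. \<rho> t \<in> V \<and> move R (\<rho> t) (\<rho> (Suc t)))"

text \<open>A strategy \<open>\<sigma>\<close> of the cops maps the list of robber positions seen so far to the list of
  cop positions: \<open>\<sigma> []\<close> is the initial placement, and \<open>\<sigma> [\<rho> 0, \<dots>, \<rho> t]\<close> is where the cops are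
  after their reply to the robber being on \<open>\<rho> t\<close>. The earlier positions of the cops are
  determined by \<open>\<sigma>\<close> and need not be arguments. As \<open>\<sigma>\<close> is deterministic, quantifying over all
  plays \<open>\<rho>\<close> covers all robbers who react to the cops.\<close>

definition cops_at :: "('a list \<Rightarrow> 'a list) \<Rightarrow> (nat \<Rightarrow> 'a) \<Rightarrow> nat \<Rightarrow> 'a list" where
  "cops_at \<sigma> \<rho> t = \<sigma> (map \<rho> [0..<t])"

text \<open>The list \<open>Ds\<close> has one entry per cop: cop \<open>i\<close> moves along the edges in \<open>Ds ! i\<close>.\<close>

definition cop_strategy ::
    "'a set \<Rightarrow> 'a set set list \<Rightarrow> 'a set set \<Rightarrow> ('a list \<Rightarrow> 'a list) \<Rightarrow> bool" where
  "cop_strategy V Ds R \<sigma> \<longleftrightarrow>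
     length (\<sigma> []) = length Ds \<and> set (\<sigma> []) \<subseteq> V \<and>
     (\<forall>\<rho> t. robber_play V R \<rho> \<longrightarrow>
        length (cops_at \<sigma> \<rho> (Suc t)) = length Ds \<and>
        (\<forall>i < length Ds. move (Ds ! i) (cops_at \<sigma> \<rho> t ! i) (cops_at \<sigma> \<rho> (Suc t) ! i)))"

text \<open>While the robber is on \<open>\<rho> t\<close>, the cops are first on \<open>cops_at \<sigma> \<rho> t\<close> and then, after their
  turn, on \<open>cops_at \<sigma> \<rho> (Suc t)\<close>; they win if either contains \<open>\<rho> t\<close>.\<close>

definition cops_win :: "'a set \<Rightarrow> 'a set set list \<Rightarrow> 'a set set \<Rightarrow> bool" where
  "cops_win V Ds R \<longleftrightarrow>
     (\<exists>\<sigma>. cop_strategy V Ds R \<sigma> \<and>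
        (\<forall>\<rho>. robber_play V R \<rho> \<longrightarrow>
           (\<exists>t. \<rho> t \<in> set (cops_at \<sigma> \<rho> t) \<union> set (cops_at \<sigma> \<rho> (Suc t)))))"


section \<open>Cop numbers\<close>

definition cop_number :: "'a set \<Rightarrow> 'a set set \<Rightarrow> nat" where
  "cop_number V E = (LEAST k. cops_win V (replicate k E) E)"

text \<open>The allocation \<open>ks\<close> gives \<open>ks ! j\<close> cops to layer \<open>Cs ! j\<close>.\<close>

definition allocate :: "nat list \<Rightarrow> 'b list \<Rightarrow> 'b list" where
  "allocate ks Cs = concat (map2 replicate ks Cs)"

definition multi_layer_cop_number :: "'a set \<Rightarrow> 'a set set list \<Rightarrow> 'a set set \<Rightarrow> nat" where
  "multi_layer_cop_number V Cs R =
     (LEAST k. \<exists>ks. length ks = length Cs \<and> sum_list ks = k \<and> cops_win V (allocate ks Cs) R)"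

text \<open>Both minima are attained: one cop per vertex always suffices.\<close>

lemma cops_win_card:
  assumes "finite V" "length Ds = card V"
  shows "cops_win V Ds R"
proof -
  obtain xs where xs: "set xs = V" "distinct xs"
    using finite_distinct_list[OF assms(1)] by blast
  have "cop_strategy V Ds R (\<lambda>_. xs)"
    using xs assms distinct_card[OF xs(2)]
    by (simp add: cop_strategy_def cops_at_def move_def)
  then show ?thesis
    unfolding cops_win_def using xs
    by (intro exI[of _ "\<lambda>_. xs"]) (auto simp: cops_at_def robber_play_def)
qed

lemma cops_win_cop_number:
  assumes "finite V"
  shows "cops_win V (replicate (cop_number V E) E) E"
  unfolding cop_number_def by (rule LeastI[of _ "card V"]) (simp add: cops_win_card assms)

lemma cops_win_multi_layer_cop_number:
  assumes "finite V" "Cs \<noteq> []"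
  shows "\<exists>ks. length ks = length Cs \<and> sum_list ks = multi_layer_cop_number V Cs R \<and>
           cops_win V (allocate ks Cs) R"
proof -
  obtain C Cs' where Cs: "Cs = C # Cs'" using assms(2) by (cases Cs) auto
  have "length (concat (map2 replicate (replicate (length Cs') 0) Cs')) = 0"
    by (induction Cs') auto
  then have "cops_win V (allocate (card V # replicate (length Cs') 0) Cs) R"
    by (intro cops_win_card assms) (simp add: Cs allocate_def)
  then have "\<exists>ks. length ks = length Cs \<and> sum_list ks = card V \<and> cops_win V (allocate ks Cs) R"
    by (intro exI[of _ "card V # replicate (length Cs') 0"]) (simp add: Cs sum_list_replicate)
  then show ?thesis
    unfolding multi_layer_cop_number_def by (rule LeastI)
qed

end

(* The robber layer is complete and both cop layers are the same path. A cop on the path threatens at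
   most three vertices, so against fewer than k cops on 3k vertices the robber can always jump to a
   vertex that no cop occupies or can reach with the next move. *)

theory Submission
  imports Defs
begin

definition path_edges :: "nat \<Rightarrow> nat set set" where
  "path_edges n = {{i, Suc i} | i. Suc i < n}"

lemma path_edges_subset_two_subsets: "path_edges n \<subseteq> two_subsets {..<n}"
  by (auto simp: path_edges_def two_subsets_def)

lemma doubleton_mem_path_edges:
  "{u, v} \<in> path_edges n \<longleftrightarrow> (v = Suc u \<and> v < n) \<or> (u = Suc v \<and> u < n)"
  by (auto simp: path_edges_def doubleton_eq_iff)

text \<open>Any two vertices are joined through 0: walk along the path from 0 to each, then reverse
  one walk by symmetry. Allowing any \<open>E\<close> above the path treats the cop layers and the
  complete robber layer at once.\<close>

lemma connected_graph_of_path_edges: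
  assumes "n > 0" "path_edges n \<subseteq> E"
  shows "Digraph_Component.connected (graph_of {..<n} E)"
proof -
  let ?G = "with_proj (mk_symmetric (graph_of {..<n} E))"
  have verts: "verts ?G = {..<n}"
    by (simp add: graph_of_def)
  \<comment> \<open>\<open>connected\<close> means strong connectivity of the symmetric closure,
    which adds no arcs here since edges are unordered pairs.\<close>
  have arcs: "arcs_ends ?G = {(u, v). {u, v} \<in> E}"
    by (auto simp: arcs_ends_conv parcs_mk_symmetric graph_of_def insert_commute)
  have sym: "symmetric ?G"
    unfolding symmetric_def arcs by (auto simp: sym_def insert_commute)
  have from_0: "0 \<rightarrow>\<^sup>*\<^bsub>?G\<^esub> v" if "v < n" for v
    using that
  proof (induction v)
    case 0
    then show ?case
      unfolding reachable_def verts by simp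
  next
    case (Suc v)
    then have "{v, Suc v} \<in> E"
      using assms(2) by (auto simp: doubleton_mem_path_edges)
    moreover have "0 \<rightarrow>\<^sup>*\<^bsub>?G\<^esub> v"
      using Suc by simp
    ultimately show ?case
      using Suc.prems rtrancl_on_into_rtrancl_on[of 0 v "{..<n}" _ "Suc v"]
      unfolding reachable_def verts arcs by blast
  qed
  have "u \<rightarrow>\<^sup>*\<^bsub>?G\<^esub> v" if "u < n" "v < n" for u v
    using symmetric_reachable[OF sym from_0[OF that(1)]] from_0[OF that(2)]
    unfolding reachable_def by (rule rtrancl_on_trans)
  then show ?thesis
    using assms(1) unfolding connected_def strongly_connected_def verts by auto
qed

lemma cop_number_le:
  assumes "cops_win V (replicate k E) E"
  shows "cop_number V E \<le> k"
  unfolding cop_number_def using assms by (rule Least_le)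

lemma move_two_subsets: "\<lbrakk>u \<in> V; v \<in> V\<rbrakk> \<Longrightarrow> move (two_subsets V) u v"
  by (auto simp: move_def two_subsets_def card_2_iff)

lemma cop_number_two_subsets:
  assumes "v \<in> V"
  shows "cop_number V (two_subsets V) \<le> 1"
proof (rule cop_number_le)
  \<comment> \<open>The cop answers each robber position by jumping onto it, so the capture comes
    with the first reply.\<close>
  let ?\<sigma> = "\<lambda>xs. [if xs = [] then v else last xs]"
  have "move (two_subsets V) (cops_at ?\<sigma> \<rho> t ! 0) (cops_at ?\<sigma> \<rho> (Suc t) ! 0)"
    if "robber_play V (two_subsets V) \<rho>" for \<rho> t
    using that assms by (cases t) (auto simp: cops_at_def robber_play_def intro!: move_two_subsets)
  then have "cop_strategy V (replicate 1 (two_subsets V)) (two_subsets V) ?\<sigma>"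
    using assms by (auto simp: cop_strategy_def cops_at_def)
  moreover have "\<rho> 0 \<in> set (cops_at ?\<sigma> \<rho> (Suc 0))" for \<rho>
    by (simp add: cops_at_def)
  ultimately show "cops_win V (replicate 1 (two_subsets V)) (two_subsets V)"
    unfolding cops_win_def by blast
qed

(* The cop walks from the end 0 towards the other end, without looking at the robber. *)
lemma cop_number_path_edges:
  assumes "n > 0"
  shows "cop_number {..<n} (path_edges n) \<le> 1"
proof (rule cop_number_le)
  \<comment> \<open>\<open>length xs\<close> counts the turns the cop has taken; the cap parks the
    cop on the last vertex.\<close>
  let ?\<sigma> = "\<lambda>xs :: nat list. [min (length xs) (n - 1)]"
  have at: "cops_at ?\<sigma> \<rho> t = [min t (n - 1)]" for \<rho> t
    by (simp add: cops_at_def)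
  have "cop_strategy {..<n} (replicate 1 (path_edges n)) (path_edges n) ?\<sigma>"
    using assms
    by (auto simp: cop_strategy_def cops_at_def move_def doubleton_mem_path_edges min_def)
  moreover have "\<exists>t. \<rho> t \<in> set (cops_at ?\<sigma> \<rho> t) \<union> set (cops_at ?\<sigma> \<rho> (Suc t))"
    if play: "robber_play {..<n} (path_edges n) \<rho>" for \<rho>
  proof (rule ccontr)
    assume "\<not> ?thesis"
    then have free: "\<rho> t \<noteq> min t (n - 1)" "\<rho> t \<noteq> min (Suc t) (n - 1)" for t
      unfolding at by auto
    have bound: "\<rho> t < n" for t
      using play by (auto simp: robber_play_def)
    \<comment> \<open>The robber cannot slip past: if he is at or beyond \<open>t\<close> but on
      neither \<open>t\<close> nor \<open>Suc t\<close>, he is at least at \<open>t + 2\<close>, so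
      one step back still leaves him at or beyond \<open>Suc t\<close>.\<close>
    have ahead: "t \<le> \<rho> t" if "t < n" for t
      using that
    proof (induction t)
      case (Suc t)
      have "\<rho> (Suc t) = \<rho> t \<or> \<rho> (Suc t) = Suc (\<rho> t) \<or> \<rho> t = Suc (\<rho> (Suc t))"
        using play by (auto simp: robber_play_def move_def doubleton_mem_path_edges)
      with Suc free[of t] show ?case
        by auto
    qed simp
    \<comment> \<open>At time \<open>n - 1\<close> the robber is squeezed onto the last vertex,
      where the cop already stands.\<close>
    show False
      using ahead[of "n - 1"] bound[of "n - 1"] free(1)[of "n - 1"] assms by auto
  qed
  ultimately show "cops_win {..<n} (replicate 1 (path_edges n)) (path_edges n)"
    unfolding cops_win_def by blast
qed

text \<open>The robber can jump anywhere, so he only needs one vertex outside all closed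
  neighbourhoods of the cops, and \<open>few\<close> leaves such a vertex by a union bound.\<close>

lemma not_cops_win_two_subsets:
  assumes "finite V"
    and small: "\<And>D p. D \<in> set Ds \<Longrightarrow> finite {q. move D p q} \<and> card {q. move D p q} \<le> d"
    and few: "d * length Ds < card V"
  shows "\<not> cops_win V Ds (two_subsets V)"
proof
  assume "cops_win V Ds (two_subsets V)"
  then obtain \<sigma> where strat: "cop_strategy V Ds (two_subsets V) \<sigma>"
    and win: "\<And>\<rho>. robber_play V (two_subsets V) \<rho> \<Longrightarrow>
      \<exists>t. \<rho> t \<in> set (cops_at \<sigma> \<rho> t) \<union> set (cops_at \<sigma> \<rho> (Suc t))"
    unfolding cops_win_def by blast
  \<comment> \<open>Since \<open>move\<close> allows staying, this covers the occupied vertices as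
    well as those reachable on the next turn.\<close>
  define threat where "threat ps = (\<Union>i<length Ds. {q. move (Ds ! i) (ps ! i) q})" for ps
  have "\<exists>v\<in>V. v \<notin> threat ps" for ps
  proof -
    have "card (threat ps) \<le> (\<Sum>i<length Ds. card {q. move (Ds ! i) (ps ! i) q})"
      unfolding threat_def by (rule card_UN_le) simp
    also have "\<dots> \<le> (\<Sum>i<length Ds. d)"
      by (rule sum_mono) (use small in auto)
    also have "\<dots> < card V"
      using few by (simp add: mult.commute)
    finally have "card (threat ps) < card V" .
    moreover have "finite (threat ps)"
      unfolding threat_def using small by auto
    ultimately show ?thesis
      using card_mono[of "threat ps" V] by fastforce
  qed
  then obtain f where f: "\<And>ps. f ps \<in> V" "\<And>ps. f ps \<notin> threat ps"
    by metis
  \<comment> \<open>Each robber position depends on the reply of \<open>\<sigma>\<close> to all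
    earlier ones, so the history is built first by recursion and \<open>\<rho>\<close> is read off
    from it.\<close>
  define h where "h = rec_nat [] (\<lambda>_ xs. xs @ [f (\<sigma> xs)])"
  define \<rho> where "\<rho> t = f (\<sigma> (h t))" for t
  have h: "h t = map \<rho> [0..<t]" for t
    by (induction t) (simp_all add: h_def \<rho>_def)
  have evade: "\<rho> t \<notin> threat (cops_at \<sigma> \<rho> t)" for t
    using f(2) by (simp add: \<rho>_def cops_at_def flip: h)
  have play: "robber_play V (two_subsets V) \<rho>"
    using f(1) by (auto simp: robber_play_def \<rho>_def intro: move_two_subsets)
  have len: "length (cops_at \<sigma> \<rho> t) = length Ds" for t
    using strat play by (cases t) (auto simp: cop_strategy_def cops_at_def)
  obtain t where t: "\<rho> t \<in> set (cops_at \<sigma> \<rho> t) \<union> set (cops_at \<sigma> \<rho> (Suc t))"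
    using win[OF play] by blast
  then obtain i where i: "i < length Ds"
    "\<rho> t = cops_at \<sigma> \<rho> t ! i \<or> \<rho> t = cops_at \<sigma> \<rho> (Suc t) ! i"
    by (auto simp: in_set_conv_nth len)
  have "move (Ds ! i) (cops_at \<sigma> \<rho> t ! i) (cops_at \<sigma> \<rho> (Suc t) ! i)"
    using strat play i(1) by (auto simp: cop_strategy_def)
  \<comment> \<open>Both kinds of capture land in the threatened set: a cop already on
    \<open>\<rho> t\<close> threatens it by staying, and a cop arriving there has just made the
    move.\<close>
  with i have "move (Ds ! i) (cops_at \<sigma> \<rho> t ! i) (\<rho> t)"
    by (auto simp: move_def)
  with evade[of t] i(1) show False
    by (auto simp: threat_def)
qed

lemma path_edges_neighbourhood:
  "finite {q. move (path_edges n) p q} \<and> card {q. move (path_edges n) p q} \<le> 3"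
proof -
  \<comment> \<open>Subtraction is truncated: at \<open>p = 0\<close> the left neighbour collapses
    to \<open>p\<close> itself, which only shrinks the set.\<close>
  have sub: "{q. move (path_edges n) p q} \<subseteq> {p - 1, p, Suc p}"
    by (auto simp: move_def doubleton_mem_path_edges)
  moreover have "card {p - 1, p, Suc p} \<le> 3"
    by (simp add: card_insert_if)
  ultimately show ?thesis
    using card_mono[OF _ sub] finite_subset[OF sub] by fastforce
qed

theorem theorem3p8:
  shows "\<exists>A::real. A > 0 \<and>
    (\<forall>k::nat. k \<ge> 1 \<longrightarrow>
      (\<exists>(V :: nat set) C1 C2 R.
         multi_layer_graph V [C1, C2] R \<and>
         real (card V) \<le> A * real k ^ 3 \<and>
         Digraph_Component.connected (graph_of V R) \<and>
         Digraph_Component.connected (graph_of V C1) \<and>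
         Digraph_Component.connected (graph_of V C2) \<and>
         cop_number V R \<le> 3 \<and>
         cop_number V C1 \<le> 2 \<and>
         cop_number V C2 \<le> 2 \<and>
         multi_layer_cop_number V [C1, C2] R \<ge> k))"
proof (intro exI[of _ 3] conjI allI impI)
  fix k :: nat
  assume k: "k \<ge> 1"
  \<comment> \<open>With at most 3 vertices threatened per cop, fewer than \<open>k\<close> cops
    threaten fewer than \<open>3 * k\<close>. As \<open>k \<ge> 1\<close>,
    \<open>3 * k \<le> 3 * k ^ 3\<close>, whence the constant 3.\<close>
  let ?V = "{..<3 * k}" and ?C = "path_edges (3 * k)"
  let ?R = "two_subsets ?V"
  have "multi_layer_graph ?V [?C, ?C] ?R"
    by (simp add: multi_layer_graph_def path_edges_subset_two_subsets)
  moreover have "real (card ?V) \<le> 3 * real k ^ 3"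
    using self_le_power[of "real k" 3] k by simp
  moreover have "Digraph_Component.connected (graph_of ?V ?R)"
    "Digraph_Component.connected (graph_of ?V ?C)"
    using k by (simp_all add: connected_graph_of_path_edges path_edges_subset_two_subsets)
  moreover have "cop_number ?V ?R \<le> 3"
    using cop_number_two_subsets[of 0 ?V] k by simp
  moreover have "cop_number ?V ?C \<le> 2"
    using cop_number_path_edges[of "3 * k"] k by simp
  moreover have "multi_layer_cop_number ?V [?C, ?C] ?R \<ge> k"
  proof (rule ccontr)
    assume less: "\<not> ?thesis"
    \<comment> \<open>The minimum is attained, so a value below \<open>k\<close> yields an actual
      winning allocation.\<close>
    obtain ks where ks: "length ks = length [?C, ?C]"
      "sum_list ks = multi_layer_cop_number ?V [?C, ?C] ?R" "cops_win ?V (allocate ks [?C, ?C]) ?R"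
      using cops_win_multi_layer_cop_number[of ?V "[?C, ?C]" ?R] by auto
    then obtain a b where "ks = [a, b]"
      by (auto simp: length_Suc_conv)
    \<comment> \<open>The two cop layers coincide, so only the total number of cops matters, not how
      it is split.\<close>
    then have "allocate ks [?C, ?C] = replicate (sum_list ks) ?C"
      by (simp add: allocate_def replicate_add)
    then have "cops_win ?V (replicate (sum_list ks) ?C) ?R"
      using ks(3) by simp
    moreover have "3 * length (replicate (sum_list ks) ?C) < card ?V"
      using ks(2) less by simp
    ultimately show False
      using not_cops_win_two_subsets[of ?V "replicate (sum_list ks) ?C" 3]
        path_edges_neighbourhood by (metis finite_lessThan in_set_replicate)
  qed
  ultimately show "\<exists>(V :: nat set) C1 C2 R.
         multi_layer_graph V [C1, C2] R \<and>
         real (card V) \<le> 3 * real k ^ 3 \<and>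
         Digraph_Component.connected (graph_of V R) \<and>
         Digraph_Component.connected (graph_of V C1) \<and>
         Digraph_Component.connected (graph_of V C2) \<and>
         cop_number V R \<le> 3 \<and>
         cop_number V C1 \<le> 2 \<and>
         cop_number V C2 \<le> 2 \<and>
         multi_layer_cop_number V [C1, C2] R \<ge> k"
    by (intro exI[of _ ?V] exI[of _ ?C] exI[of _ ?R] conjI)
qed simp

end
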